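(* Let $\boldsymbol{\ell},\boldsymbol{u}\in\mathbb{Z}_{\ge0}^n$ with $u_i\in\{\ell_i,\ell_i+1\}$ for all $i\in[n]$, and for each integer $m$ let $w_m=|\mathcal{G}_m(\boldsymbol{\ell},\boldsymbol{u})|$. Let $m_1$ and $m_2$ be the minimum and maximum number of edges of a graph in $\mathcal{G}(\boldsymbol{\ell},\boldsymbol{u})$. Then the sequence $(w_m)_{m_1\le m\le m_2}$ is log-concave, i.e., $w_{m-1}w_{m+1}\le w_m^2$ for every $m$ with $m_1<m<m_2$.
   Context: $\mathcal{G}(\boldsymbol{\ell},\boldsymbol{u})$ is the set of simple labelled graphs $G$ on node set $[n]$ with $\ell_i\le d_i(G)\le u_i$ for all $i$, where $d_i(G)$ is the degree of node $i$; $\mathcal{G}_m(\boldsymbol{\ell},\boldsymbol{u})$ is the subset of those graphs with exactly $m$ edges. *)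

theory Defs
  imports Main
begin

text \<open>A simple labelled graph on the node set \<open>{1..n}\<close> is represented by its edge set, a set of
  two-element subsets of \<open>{1..n}\<close>; the node set is fixed, so the edge set determines the graph.\<close>

type_synonym edge_set = "nat set set"

definition simple_graphs :: "nat \<Rightarrow> edge_set set" where
  "simple_graphs n = {E. \<forall>e\<in>E. e \<subseteq> {1..n} \<and> card e = 2}"

definition degree :: "edge_set \<Rightarrow> nat \<Rightarrow> nat" where
  "degree E i = card {e \<in> E. i \<in> e}"

text \<open>Only the values of \<open>l\<close> and \<open>u\<close> on \<open>{1..n}\<close> are relevant.\<close>

definition graphs_deg :: "nat \<Rightarrow> (nat \<Rightarrow> nat) \<Rightarrow> (nat \<Rightarrow> nat) \<Rightarrow> edge_set set" where
  "graphs_deg n l u = {E \<in> simple_graphs n. \<forall>i\<in>{1..n}. l i \<le> degree E i \<and> degree E i \<le> u i}"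

definition graphs_deg_edges ::
    "nat \<Rightarrow> (nat \<Rightarrow> nat) \<Rightarrow> (nat \<Rightarrow> nat) \<Rightarrow> nat \<Rightarrow> edge_set set" where
  "graphs_deg_edges n l u m = {E \<in> graphs_deg n l u. card E = m}"

end

theory Submission
  imports Defs "HOL-Library.Disjoint_Sets" "HOL-Library.Multiset"
begin

text \<open>Fix the intersection \<open>C\<close> and the union \<open>U\<close> of a pair of graphs \<open>(A, B)\<close>, and colour the edges of
  \<open>H = U - C\<close> red (in \<open>A\<close>) or blue (in \<open>B\<close>). As the degree intervals have length at most one, both
  graphs are admissible only if red and blue differ by at most one at every node, and if one such
  colouring is admissible then all are. Among the balanced colourings, those with two more blue than
  red edges are at most as many as the equitable ones. To see this, pair up red and blue edges
  at each node; the number of pairings does not depend on the colouring. For a fixed pairing the edges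
  split into components, each with a colour surplus of at most one, that can be recoloured independently,
  and the claim is an inequality between adjacent binomial coefficients near the middle.\<close>

section \<open>Balanced subsets and removal of a bichromatic pair\<close>

text \<open>For finite \<open>S\<close>: the numbers of elements of \<open>S\<close> inside and
  outside \<open>R\<close> differ by at most one. Doubling avoids subtraction.\<close>

definition balanced :: "'a set \<Rightarrow> 'a set \<Rightarrow> bool" where
  "balanced S R \<longleftrightarrow> 2 * card (S \<inter> R) \<le> card S + 1 \<and> card S \<le> 2 * card (S \<inter> R) + 1"

text \<open>The constraints form a multiset because equal ones, such as the stars at both ends of an
  isolated edge, must count separately when covers are counted.\<close>

definition balanced_subsets :: "'a set \<Rightarrow> 'a set multiset \<Rightarrow> nat \<Rightarrow> 'a set set" where
  "balanced_subsets H M j = {R. R \<subseteq> H \<and> card R = j \<and> (\<forall>S\<in>#M. balanced S R)}"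

lemma finite_balanced_subsets [simp]: "finite H \<Longrightarrow> finite (balanced_subsets H M j)"
  unfolding balanced_subsets_def by (rule finite_subset[of _ "Pow H"]) auto

lemma card_Int_add_Diff: "finite S \<Longrightarrow> card (S \<inter> R) + card (S - R) = card S"
  by (metis card_Int_Diff)

lemma balanced_iff_Diff:
  assumes "finite S"
  shows "balanced S R \<longleftrightarrow> card (S \<inter> R) \<le> card (S - R) + 1 \<and> card (S - R) \<le> card (S \<inter> R) + 1"
  using card_Int_add_Diff[OF assms, of R] unfolding balanced_def by auto

lemma balanced_pair_iff:
  assumes "a \<noteq> b"
  shows "balanced {a, b} R \<longleftrightarrow> (a \<in> R) \<noteq> (b \<in> R)"
  using assms unfolding balanced_def by (cases "a \<in> R"; cases "b \<in> R") (simp_all add: Int_insert_left)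

text \<open>One element of each colour is removed, so the colour difference is unchanged.\<close>

lemma balanced_Diff_pair_iff:
  assumes "finite S" "a \<in> S" "b \<in> S" "(a \<in> R) \<noteq> (b \<in> R)"
  shows "balanced (S - {a, b}) R \<longleftrightarrow> balanced S R"
proof -
  have ab: "a \<noteq> b" using assms by auto
  have c: "card (S - {a, b}) + 2 = card S"
    using assms ab card_Diff_subset[of "{a,b}" S] card_mono[of S "{a,b}"] by auto
  obtain x where x: "x \<in> S \<inter> R" "(S - {a, b}) \<inter> R = S \<inter> R - {x}"
    using assms by (cases "a \<in> R") auto
  have "card ((S - {a, b}) \<inter> R) + 1 = card (S \<inter> R)"
    using x assms(1) by (metis Suc_eq_plus1 card_Suc_Diff1 finite_Int)
  with c show ?thesis unfolding balanced_def by auto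
qed

section \<open>Averaging over the ways to split off a pair\<close>

text \<open>Balance forces the two colour counts to be the floor and ceiling of
  \<open>card S / 2\<close> in some order, so their product does not depend on
  \<open>R\<close>.\<close>

lemma card_separated_pairs:
  assumes "finite S" "balanced S R"
  shows "card {p \<in> S \<times> S. (fst p \<in> R) \<noteq> (snd p \<in> R)} = 2 * ((card S div 2) * (Suc (card S) div 2))"
proof -
  have "{p \<in> S \<times> S. (fst p \<in> R) \<noteq> (snd p \<in> R)} =
      (S \<inter> R) \<times> (S - R) \<union> (S - R) \<times> (S \<inter> R)" by auto
  moreover have "card ((S \<inter> R) \<times> (S - R) \<union> (S - R) \<times> (S \<inter> R)) =
      2 * (card (S \<inter> R) * card (S - R))"
    using assms(1) by (subst card_Un_disjoint) (auto simp: card_cartesian_product)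
  moreover have "card (S \<inter> R) = card S div 2 \<and> card (S - R) = Suc (card S) div 2 \<or>
      card (S \<inter> R) = Suc (card S) div 2 \<and> card (S - R) = card S div 2"
    using card_Int_add_Diff[OF assms(1), of R] assms(2)
    unfolding balanced_iff_Diff[OF assms(1)] by presburger
  ultimately show ?thesis by (elim disjE) (simp_all add: mult.commute)
qed

text \<open>The pairing is built one pair at a time: a constraint \<open>S\<close> is averaged over all its refinements into
  \<open>{a, b}\<close> and \<open>S - {a, b}\<close>.\<close>

lemma sum_balanced_subsets_split:
  assumes H: "finite H" and S: "finite S"
  shows "(\<Sum>p\<in>{p \<in> S \<times> S. fst p \<noteq> snd p}.
        card (balanced_subsets H (add_mset {fst p, snd p} (add_mset (S - {fst p, snd p}) M)) j)) =
      2 * ((card S div 2) * (Suc (card S) div 2)) * card (balanced_subsets H (add_mset S M) j)"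
    (is "sum ?g ?T = ?c * card ?B")
proof -
  have eq: "balanced_subsets H (add_mset {fst p, snd p} (add_mset (S - {fst p, snd p}) M)) j =
      {R \<in> ?B. (fst p \<in> R) \<noteq> (snd p \<in> R)}" if "p \<in> ?T" for p
    using that balanced_Diff_pair_iff[OF S, of "fst p" "snd p"]
    by (auto simp: balanced_subsets_def balanced_pair_iff)
  have "sum ?g ?T = (\<Sum>p\<in>?T. card {R \<in> ?B. (fst p \<in> R) \<noteq> (snd p \<in> R)})"
    by (rule sum.cong) (simp_all only: eq)
  \<comment> \<open>Double counting of incidences \<open>(p, R)\<close>: every balanced
    \<open>R\<close> separates the same number of ordered pairs.\<close>
  also have "\<dots> = ?c * card ?B"
  proof (rule sum_multicount)
    show "\<forall>R\<in>?B. card {p \<in> ?T. (fst p \<in> R) \<noteq> (snd p \<in> R)} = ?c"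
    proof
      fix R assume "R \<in> ?B"
      then have "balanced S R" by (simp add: balanced_subsets_def)
      moreover have "{p \<in> ?T. (fst p \<in> R) \<noteq> (snd p \<in> R)} =
          {p \<in> S \<times> S. (fst p \<in> R) \<noteq> (snd p \<in> R)}" by auto
      ultimately show "card {p \<in> ?T. (fst p \<in> R) \<noteq> (snd p \<in> R)} = ?c"
        by (simp only: card_separated_pairs[OF S])
    qed
  qed (use H S in auto)
  finally show ?thesis .
qed

section \<open>Classes generated by a system of pairs\<close>

lemma size_filter_mset_disjoint:
  assumes "\<And>x. x \<in># L \<Longrightarrow> P x \<or> Q x \<Longrightarrow> T x" "\<And>x. x \<in># L \<Longrightarrow> \<not> (P x \<and> Q x)"
  shows "size (filter_mset P L) + size (filter_mset Q L) \<le> size (filter_mset T L)"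
  using assms
proof (induction L)
  case (add x L)
  then have "size (filter_mset P L) + size (filter_mset Q L) \<le> size (filter_mset T L)" by simp
  with add.prems[of x] show ?case by auto
qed simp

text \<open>Regard the pairs as edges of a multigraph on \<open>H\<close> and take its connected
  components: a component with \<open>k\<close> vertices has at least \<open>k - 1\<close> edges.
  Pairs are inserted one by one, merging the classes of their ends.\<close>

lemma pairs_refine_partition:
  assumes "finite H" "\<forall>S\<in>#L. S \<subseteq> H \<and> card S = 2"
  shows "\<exists>P. partition_on H P \<and> (\<forall>S\<in>#L. \<exists>K\<in>P. S \<subseteq> K) \<and>
    (\<forall>K\<in>P. card K \<le> Suc (size {#S \<in># L. S \<subseteq> K#}))"
  using assms(2)
proof (induction L)
  case empty
  have "partition_on H ((\<lambda>x. {x}) ` H)"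
    by (auto simp: partition_on_def disjoint_def)
  then show ?case by (intro exI[of _ "(\<lambda>x. {x}) ` H"]) auto
next
  case (add S L)
  then obtain P where P: "partition_on H P" "\<forall>S\<in>#L. \<exists>K\<in>P. S \<subseteq> K"
    "\<forall>K\<in>P. card K \<le> Suc (size {#S \<in># L. S \<subseteq> K#})" by auto
  obtain a b where S: "S = {a, b}" "a \<noteq> b" "a \<in> H" "b \<in> H"
    using add.prems by (auto simp: card_2_iff)
  obtain K1 K2 where K: "K1 \<in> P" "a \<in> K1" "K2 \<in> P" "b \<in> K2"
    using S P(1) unfolding partition_on_def by blast
  show ?case
  proof (cases "K1 = K2")
    case True
    then show ?thesis using P S K by (intro exI[of _ P]) force
  next
    case False
    let ?K = "K1 \<union> K2" and ?P = "insert (K1 \<union> K2) (P - {K1, K2})"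
    have disj: "K1 \<inter> K2 = {}"
      using P(1) K False by (auto simp: partition_on_def disjoint_def)
    have part: "partition_on H ?P"
      using P(1) K unfolding partition_on_def disjoint_def by (auto; blast)
    have cov: "\<forall>S\<in>#add_mset S L. \<exists>K\<in>?P. S \<subseteq> K"
      using P(2) S K by (auto; blast)
    have le: "card ?K \<le> Suc (size {#S' \<in># add_mset S L. S' \<subseteq> ?K#})"
    proof -
      have "size {#S \<in># L. S \<subseteq> K1#} + size {#S \<in># L. S \<subseteq> K2#} \<le> size {#S \<in># L. S \<subseteq> ?K#}"
      proof (rule size_filter_mset_disjoint)
        fix T assume "T \<in># L"
        then have "card T = 2" using add.prems by auto
        then have "T \<noteq> {}" by auto
        then show "\<not> (T \<subseteq> K1 \<and> T \<subseteq> K2)" using disj by blast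
      qed auto
      moreover have "card ?K \<le> card K1 + card K2" by (rule card_Un_le)
      moreover have "card K1 \<le> Suc (size {#S \<in># L. S \<subseteq> K1#})" "card K2 \<le> Suc (size {#S \<in># L. S \<subseteq> K2#})"
        using P(3) K by auto
      \<comment> \<open>The bounds for \<open>K1\<close> and \<open>K2\<close> together carry two
        extra units; the new pair lies in the merged class and absorbs one.\<close>
      moreover have "S \<subseteq> ?K" using S K by auto
      ultimately show ?thesis by simp
    qed
    show ?thesis
    proof (intro exI[of _ ?P] conjI part cov ballI)
      fix K assume "K \<in> ?P"
      then show "card K \<le> Suc (size {#S' \<in># add_mset S L. S' \<subseteq> K#})"
        using le P(3) by (cases "K = ?K") (auto intro: le_SucI)
    qed
  qed
qed

text \<open>A pair inside \<open>K\<close> meets \<open>R\<close> in an element of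
  \<open>K \<inter> R\<close>, so it is counted at least once in the incidence sum.\<close>

lemma size_subsets_le_sum_degree:
  assumes "finite K" "\<forall>S\<in>#L. S \<inter> R \<noteq> {}"
  shows "size {#S \<in># L. S \<subseteq> K#} \<le> (\<Sum>e\<in>K \<inter> R. size {#S \<in># L. e \<in> S#})"
  using assms(2)
proof (induction L)
  case (add S L)
  have "(\<Sum>e\<in>K \<inter> R. size {#T \<in># add_mset S L. e \<in> T#}) =
      (\<Sum>e\<in>K \<inter> R. size {#T \<in># L. e \<in> T#} + (if e \<in> S then 1 else 0))"
    by (rule sum.cong) auto
  also have "\<dots> = (\<Sum>e\<in>K \<inter> R. size {#T \<in># L. e \<in> T#}) + card {e \<in> K \<inter> R. e \<in> S}"
    using assms(1) by (simp add: sum.distrib sum.If_cases Int_def)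
  finally have eq: "(\<Sum>e\<in>K \<inter> R. size {#T \<in># add_mset S L. e \<in> T#}) = \<dots>" .
  have "1 \<le> card {e \<in> K \<inter> R. e \<in> S}" if "S \<subseteq> K"
    using that add.prems assms(1) by (auto simp: Suc_le_eq card_gt_0_iff)
  with eq add show ?case by auto
qed simp

text \<open>Every pair has exactly one red element and every red element lies in at most two pairs, so \<open>K\<close>
  contains at most twice as many pairs as red elements; likewise for blue.\<close>

lemma balanced_class:
  assumes K: "finite K" "card K \<le> Suc (size {#S \<in># L. S \<subseteq> K#})"
    and L: "\<forall>S\<in>#L. card S = 2 \<and> balanced S R"
    and deg: "\<And>e. size {#S \<in># L. e \<in> S#} \<le> 2"
  shows "balanced K R"
proof -
  have *: "size {#S \<in># L. S \<subseteq> K#} \<le> 2 * card (K \<inter> R')" if "\<forall>S\<in>#L. S \<inter> R' \<noteq> {}" for R'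
    using size_subsets_le_sum_degree[OF K(1) that]
      sum_bounded_above[of "K \<inter> R'" "\<lambda>e. size {#S \<in># L. e \<in> S#}" 2] deg by (simp add: mult.commute)
  have sep: "S \<inter> R \<noteq> {} \<and> S \<inter> - R \<noteq> {}" if "S \<in># L" for S
  proof -
    have "card S = 2" "balanced S R" using that L by auto
    moreover from this obtain a b where "S = {a, b}" "a \<noteq> b" unfolding card_2_iff by blast
    ultimately show ?thesis using balanced_pair_iff[of a b R] by auto
  qed
  \<comment> \<open>For \<open>R\<close>, \<open>card K \<le> 1 + 2 * card (K \<inter> R)\<close>
    bounds the blue surplus by one; the complement gives the same for red.\<close>
  from *[of R] *[of "- R"] sep K(2) card_Int_add_Diff[OF K(1), of R] show ?thesis
    unfolding balanced_iff_Diff[OF K(1)] Diff_eq by auto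
qed

section \<open>Recolouring single classes\<close>

definition flip :: "'a set \<Rightarrow> 'a set \<Rightarrow> 'a set" where
  "flip K R = (R - K) \<union> (K - R)"

lemma flip_flip [simp]: "flip K (flip K R) = R"
  unfolding flip_def by auto

lemma card_flip:
  assumes "finite R" "finite K"
  shows "card (flip K R) + card (K \<inter> R) = card R + card (K - R)"
proof -
  have "card (flip K R) = card (R - K) + card (K - R)"
    unfolding flip_def using assms by (subst card_Un_disjoint) auto
  with card_Int_add_Diff[OF assms(1), of K] show ?thesis by (simp add: Int_commute)
qed

lemma balanced_flip_subset:
  assumes "finite S" "S \<subseteq> K"
  shows "balanced S (flip K R) \<longleftrightarrow> balanced S R"
proof -
  have "S \<inter> flip K R = S - R" "S - flip K R = S \<inter> R" using assms by (auto simp: flip_def)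
  then show ?thesis unfolding balanced_iff_Diff[OF assms(1)] by auto
qed

lemma balanced_flip_disjoint:
  assumes "S \<inter> K = {}"
  shows "balanced S (flip K R) \<longleftrightarrow> balanced S R"
proof -
  have "S \<inter> flip K R = S \<inter> R" using assms by (auto simp: flip_def)
  then show ?thesis by (simp add: balanced_def)
qed

text \<open>When \<open>R\<close> is balanced on every class, the odd classes are exactly those with
  a majority colour; excess and deficit classes separate them by that colour.\<close>

definition excess_classes :: "'a set set \<Rightarrow> 'a set \<Rightarrow> 'a set set" where
  "excess_classes P R = {K \<in> P. card (K \<inter> R) = card (K - R) + 1}"

definition deficit_classes :: "'a set set \<Rightarrow> 'a set \<Rightarrow> 'a set set" where
  "deficit_classes P R = {K \<in> P. card (K - R) = card (K \<inter> R) + 1}"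

text \<open>A balanced class contributes 1, 0 or -1 to the difference of the colour counts; summing
  over the partition gives the first identity, and parity the second.\<close>

lemma card_excess_deficit:
  assumes H: "finite H" and P: "partition_on H P" and R: "R \<subseteq> H" "\<forall>K\<in>P. balanced K R"
  shows "card (H - R) + card (excess_classes P R) = card R + card (deficit_classes P R)"
    and "card (excess_classes P R) + card (deficit_classes P R) = card {K \<in> P. odd (card K)}"
proof -
  have fP: "finite P" using H P by (rule finite_elements)
  have fK: "finite K" if "K \<in> P" for K
    using that H P by (metis Union_upper finite_subset partition_onD1)
  have part: "card X = (\<Sum>K\<in>P. card (K \<inter> X))" if "X \<subseteq> H" for X
  proof -
    have "X = (\<Union>K\<in>P. K \<inter> X)" using that P by (auto simp: partition_on_def)
    moreover have "card (\<Union>K\<in>P. K \<inter> X) = (\<Sum>K\<in>P. card (K \<inter> X))"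
      using P fK fP by (intro card_UN_disjoint) (auto simp: partition_on_def disjoint_def)
    ultimately show ?thesis by simp
  qed
  have "card (H - R) + card (excess_classes P R) =
      (\<Sum>K\<in>P. card (K \<inter> (H - R)) + (if K \<in> excess_classes P R then 1 else 0))"
    using part[of "H - R"] fP
    by (simp add: sum.distrib sum.If_cases excess_classes_def Int_def)
  also have "\<dots> = (\<Sum>K\<in>P. card (K \<inter> R) + (if K \<in> deficit_classes P R then 1 else 0))"
  proof (rule sum.cong)
    fix K assume K: "K \<in> P"
    then have "K \<inter> (H - R) = K - R" using P by (auto simp: partition_on_def)
    then show "card (K \<inter> (H - R)) + (if K \<in> excess_classes P R then 1 else 0) =
        card (K \<inter> R) + (if K \<in> deficit_classes P R then 1 else 0)"
      using K R(2) balanced_iff_Diff[OF fK[OF K], of R]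
      by (auto simp: excess_classes_def deficit_classes_def)
  qed simp
  also have "\<dots> = card R + card (deficit_classes P R)"
    using part[of R] R(1) fP
    by (simp add: sum.distrib sum.If_cases deficit_classes_def Int_def)
  finally show "card (H - R) + card (excess_classes P R) = card R + card (deficit_classes P R)" .
  have "{K \<in> P. odd (card K)} = excess_classes P R \<union> deficit_classes P R"
  proof (intro set_eqI)
    fix K
    have "odd (card K) \<longleftrightarrow> card (K \<inter> R) = card (K - R) + 1 \<or> card (K - R) = card (K \<inter> R) + 1"
      if "K \<in> P"
      using that R(2) balanced_iff_Diff[OF fK[OF that], of R] card_Int_add_Diff[OF fK[OF that], of R]
      by (auto; presburger)
    then show "K \<in> {K \<in> P. odd (card K)} \<longleftrightarrow> K \<in> excess_classes P R \<union> deficit_classes P R"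
      by (auto simp: excess_classes_def deficit_classes_def)
  qed
  then show "card (excess_classes P R) + card (deficit_classes P R) = card {K \<in> P. odd (card K)}"
    using fP by (subst card_Un_disjoint[symmetric]) (auto simp: excess_classes_def deficit_classes_def)
qed

text \<open>With \<open>2 * h\<close> odd classes, a colouring at level \<open>j\<close> has
  \<open>h + 1\<close> deficit classes and one at level \<open>Suc j\<close> has \<open>h\<close>
  excess classes. Flipping a deficit class leads injectively from the former to the latter, as in
  the comparison of adjacent binomial coefficients.\<close>

lemma card_balanced_subsets_pairs:
  assumes H: "finite H" "card H = 2 * Suc j"
    and L: "\<forall>S\<in>#L. S \<subseteq> H \<and> card S = 2"
    and deg: "\<And>e. size {#S \<in># L. e \<in> S#} \<le> 2"
  shows "card (balanced_subsets H L j) \<le> card (balanced_subsets H L (Suc j))"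
    (is "card ?X \<le> card ?Y")
proof -
  obtain P where P: "partition_on H P" "\<forall>S\<in>#L. \<exists>K\<in>P. S \<subseteq> K"
    "\<forall>K\<in>P. card K \<le> Suc (size {#S \<in># L. S \<subseteq> K#})"
    using pairs_refine_partition[OF H(1) L] by auto
  define h where "h = card {K \<in> P. odd (card K)} div 2"
  have fP: "finite P" using H(1) P(1) by (rule finite_elements)
  have KH: "K \<subseteq> H" if "K \<in> P" for K using that P(1) by (auto simp: partition_on_def)
  then have fK: "finite K" if "K \<in> P" for K using that H(1) finite_subset by blast
  have bal: "\<forall>K\<in>P. balanced K R" if "\<forall>S\<in>#L. balanced S R" for R
    using balanced_class[of _ L R] that fK P(3) L deg by blast
  have X: "card (deficit_classes P R) = Suc h" if "R \<in> ?X" for R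
  proof -
    have R: "R \<subseteq> H" "card R = j" "\<forall>S\<in>#L. balanced S R" using that by (auto simp: balanced_subsets_def)
    have "card (H - R) = Suc (Suc j)"
      using R H by (simp add: card_Diff_subset finite_subset)
    with card_excess_deficit[OF H(1) P(1) R(1) bal[OF R(3)]] R(2) show ?thesis by (simp add: h_def)
  qed
  have Y: "card (excess_classes P R) = h" if "R \<in> ?Y" for R
  proof -
    have R: "R \<subseteq> H" "card R = Suc j" "\<forall>S\<in>#L. balanced S R" using that by (auto simp: balanced_subsets_def)
    have "card (H - R) = Suc j"
      using R H by (simp add: card_Diff_subset finite_subset)
    with card_excess_deficit[OF H(1) P(1) R(1) bal[OF R(3)]] R(2) show ?thesis by (simp add: h_def)
  qed
  \<comment> \<open>A colouring is recorded together with the class to be flipped, so that the flip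
    can be undone.\<close>
  have "card (Sigma ?X (deficit_classes P)) \<le> card (Sigma ?Y (excess_classes P))"
  proof (rule card_inj_on_le)
    show "inj_on (\<lambda>(R, K). (flip K R, K)) (Sigma ?X (deficit_classes P))"
      by (rule inj_on_inverseI[where g = "\<lambda>(R, K). (flip K R, K)"]) auto
    show "finite (Sigma ?Y (excess_classes P))"
      using H(1) fP by (intro finite_SigmaI) (auto simp: excess_classes_def)
    show "(\<lambda>(R, K). (flip K R, K)) ` Sigma ?X (deficit_classes P) \<subseteq> Sigma ?Y (excess_classes P)"
    proof clarify
      fix R K assume R: "R \<in> ?X" and K: "K \<in> deficit_classes P R"
      have KP: "K \<in> P" and cK: "card (K - R) = card (K \<inter> R) + 1"
        using K by (auto simp: deficit_classes_def)
      have RH: "R \<subseteq> H" "card R = j" using R by (auto simp: balanced_subsets_def)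
      then have "finite R" using H(1) finite_subset by blast
      with card_flip[of R K] fK[OF KP] cK RH have "card (flip K R) = Suc j" by simp
      moreover have "flip K R \<subseteq> H" using RH KH[OF KP] by (auto simp: flip_def)
      \<comment> \<open>Each pair lies within one class, so its colours are either both exchanged or
        both kept.\<close>
      moreover have "balanced S (flip K R)" if S: "S \<in># L" for S
      proof -
        obtain K' where K': "K' \<in> P" "S \<subseteq> K'" using P(2) S by blast
        have "balanced S R" using R S by (auto simp: balanced_subsets_def)
        moreover have "S \<inter> K = {}" if "K \<noteq> K'"
          using that P(1) K' KP by (auto simp: partition_on_def disjoint_def)
        ultimately show ?thesis
          using balanced_flip_subset[of S K R] balanced_flip_disjoint[of S K R] K' fK finite_subset
          by metis
      qed
      moreover have "K \<inter> flip K R = K - R" "K - flip K R = K \<inter> R" by (auto simp: flip_def)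
      ultimately show "flip K R \<in> ?Y \<and> K \<in> excess_classes P (flip K R)"
        using KP cK by (simp add: balanced_subsets_def excess_classes_def)
    qed
  qed
  moreover have "card (Sigma ?X (deficit_classes P)) = card ?X * Suc h"
    using H(1) fP X by (subst card_SigmaI) (auto simp: deficit_classes_def)
  moreover have "card (Sigma ?Y (excess_classes P)) = card ?Y * h"
    using H(1) fP Y by (subst card_SigmaI) (auto simp: excess_classes_def)
  \<comment> \<open>The factor \<open>h\<close> on the right is enlarged to \<open>Suc h\<close>,
    giving a common positive factor to cancel.\<close>
  ultimately have "card ?X * Suc h \<le> card ?Y * Suc h" by simp
  then show ?thesis by (metis mult_le_cancel2 zero_less_Suc)
qed

section \<open>Reduction of arbitrary constraints to pairs\<close>

text \<open>Splitting a constraint of size at least three into a pair and the rest covers each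
  element as often as before, so the cover bound survives. Averaging over all splittings transfers
  the inequality back.\<close>

lemma card_balanced_subsets_mono:
  assumes H: "finite H" "card H = 2 * Suc j"
    and M: "\<forall>S\<in>#M. S \<subseteq> H"
    and deg: "\<And>e. size {#S \<in># M. e \<in> S#} \<le> 2"
  shows "card (balanced_subsets H M j) \<le> card (balanced_subsets H M (Suc j))"
  using M deg
\<comment> \<open>Truncated subtraction gives constraints of size at most two weight zero, so every
  splitting lowers the measure.\<close>
proof (induction "\<Sum>S\<in>#M. card S - 2" arbitrary: M rule: less_induct)
  case less
  show ?case
  proof (cases "\<exists>S\<in>#M. card S \<ge> 3")
    case True
    then obtain S M' where S: "M = add_mset S M'" "card S \<ge> 3" by (metis multi_member_split)
    have fS: "finite S" using S(2) by (metis card.infinite not_numeral_le_zero)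
    let ?N = "\<lambda>p. add_mset {fst p, snd p} (add_mset (S - {fst p, snd p}) M')"
    let ?T = "{p \<in> S \<times> S. fst p \<noteq> snd p}"
    have "card (balanced_subsets H (?N p) j) \<le> card (balanced_subsets H (?N p) (Suc j))"
      if p: "p \<in> ?T" for p
    proof (rule less.hyps)
      have "card (S - {fst p, snd p}) = card S - 2"
        using p fS by (subst card_Diff_subset) auto
      then show "(\<Sum>S\<in>#?N p. card S - 2) < (\<Sum>S\<in>#M. card S - 2)"
        using p S by auto
      show "\<forall>S\<in>#?N p. S \<subseteq> H" using less.prems(1) S(1) p by auto
      show "size {#S \<in># ?N p. e \<in> S#} \<le> 2" for e
        using less.prems(2)[of e] p unfolding S(1) by (auto split: if_splits)
    qed
    then have "(\<Sum>p\<in>?T. card (balanced_subsets H (?N p) j)) \<le>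
        (\<Sum>p\<in>?T. card (balanced_subsets H (?N p) (Suc j)))"
      by (rule sum_mono)
    \<comment> \<open>Both sums are multiples of the desired cardinalities by the same factor,
      positive since \<open>card S \<ge> 3\<close>.\<close>
    then show ?thesis
      using S unfolding sum_balanced_subsets_split[OF H(1) fS] by (auto simp: div_greater_zero_iff)
  next
    case False
    let ?L = "{#S \<in># M. card S = 2#}"
    \<comment> \<open>The remaining constraints have at most one element and hold for every
      \<open>R\<close>.\<close>
    have "balanced S R" if "S \<in># M" "card S \<noteq> 2" for S R
    proof -
      have "card S \<le> 1" using that False by force
      moreover have "finite S" using that less.prems(1) H(1) finite_subset by blast
      then have "card (S \<inter> R) \<le> card S" by (simp add: card_mono)
      ultimately show ?thesis unfolding balanced_def by linarith
    qed
    then have eq: "balanced_subsets H M i = balanced_subsets H ?L i" for i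
      unfolding balanced_subsets_def by (auto; blast)
    have "size {#S \<in># ?L. e \<in> S#} \<le> 2" for e
    proof -
      have "{#S \<in># ?L. e \<in> S#} \<subseteq># {#S \<in># M. e \<in> S#}"
        by (rule multiset_filter_mono) simp
      from size_mset_mono[OF this] less.prems(2)[of e] show ?thesis by linarith
    qed
    then show ?thesis unfolding eq
      by (intro card_balanced_subsets_pairs[OF H]) (use less.prems(1) in auto)
  qed
qed

section \<open>Pairs of graphs as coloured edge sets\<close>

lemma card_le_fibers:
  assumes "finite X" "finite Y" "\<And>z. card {x \<in> X. f x = z} \<le> card {y \<in> Y. g y = z}"
  shows "card X \<le> card Y"
proof -
  let ?Z = "f ` X \<union> g ` Y"
  have "card X = (\<Sum>z\<in>?Z. card {x \<in> X. f x = z})"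
    using assms(1,2) by (subst sum.group[of X ?Z f "\<lambda>_. 1::nat", simplified]) auto
  also have "\<dots> \<le> (\<Sum>z\<in>?Z. card {y \<in> Y. g y = z})"
    by (rule sum_mono) (rule assms(3))
  also have "\<dots> = card Y"
    using assms(1,2) by (subst sum.group[of Y ?Z g "\<lambda>_. 1::nat", simplified]) auto
  finally show ?thesis .
qed

lemma finite_simple_graphs: "finite (simple_graphs n)"
  unfolding simple_graphs_def by (rule finite_subset[of _ "Pow (Pow {1..n})"]) auto

lemma finite_simple_graph: "E \<in> simple_graphs n \<Longrightarrow> finite E"
  unfolding simple_graphs_def by (rule finite_subset[of _ "Pow {1..n}"]) auto

lemma degree_Int_Diff:
  assumes "finite A" "finite B" "A \<inter> B = C" "A \<union> B = U"
  shows "degree A i = degree C i + card ({e \<in> U - C. i \<in> e} \<inter> (A - C))"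
    and "degree B i = degree C i + card ({e \<in> U - C. i \<in> e} - (A - C))"
proof -
  have "{e \<in> A. i \<in> e} = {e \<in> C. i \<in> e} \<union> ({e \<in> U - C. i \<in> e} \<inter> (A - C))"
    "{e \<in> B. i \<in> e} = {e \<in> C. i \<in> e} \<union> ({e \<in> U - C. i \<in> e} - (A - C))"
    using assms by auto
  moreover have "finite C" "finite U" using assms by auto
  ultimately show "degree A i = degree C i + card ({e \<in> U - C. i \<in> e} \<inter> (A - C))"
    "degree B i = degree C i + card ({e \<in> U - C. i \<in> e} - (A - C))"
    unfolding degree_def by (simp_all only:, (subst card_Un_disjoint; force)+)
qed

text \<open>One constraint per node, kept with multiplicity.\<close>

definition stars :: "nat \<Rightarrow> edge_set \<Rightarrow> edge_set multiset" where
  "stars n H = image_mset (\<lambda>i. {e \<in> H. i \<in> e}) (mset_set {1..n})"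

text \<open>An edge lies in the stars of its ends only.\<close>

lemma stars_cover_le_2:
  assumes "\<forall>e\<in>H. card e = 2"
  shows "size {#S \<in># stars n H. e \<in> S#} \<le> 2"
proof (cases "e \<in> H")
  case True
  have "size {#S \<in># stars n H. e \<in> S#} = card {i \<in> {1..n}. i \<in> e}"
    using True by (simp add: stars_def filter_mset_image_mset filter_mset_mset_set)
  also have "\<dots> \<le> card e"
    using assms True by (intro card_mono) (auto intro: card_ge_0_finite)
  finally show ?thesis using assms True by simp
next
  case False
  then have "{#S \<in># stars n H. e \<in> S#} = {#}"
    by (auto simp: stars_def filter_mset_eq_conv)
  then show ?thesis by (simp only: size_empty le0)
qed

text \<open>In the fibre over \<open>(C, U)\<close> a pair \<open>(A, B)\<close> is determined by
  the red set \<open>R = A - C\<close>, with inverse \<open>(C \<union> R, U - R)\<close>.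
  Admissible pairs give balanced \<open>R\<close>, and once the fibre contains one admissible pair,
  every balanced \<open>R\<close> gives admissible degrees.\<close>

lemma card_graph_pairs_fiber_le:
  assumes "\<forall>i\<in>{1..n}. u i \<in> {l i, l i + 1}"
  defines "G \<equiv> graphs_deg_edges n l u"
  shows "card {p \<in> G k \<times> G (k + 2). (fst p \<inter> snd p, fst p \<union> snd p) = z} \<le>
    card {p \<in> G (k + 1) \<times> G (k + 1). (fst p \<inter> snd p, fst p \<union> snd p) = z}"
    (is "card ?X \<le> card ?Y")
proof (cases "?X = {}")
  case False
  obtain C U where z: "z = (C, U)" by fastforce
  obtain A0 B0 where AB0: "A0 \<in> G k" "B0 \<in> G (k + 2)" "A0 \<inter> B0 = C" "A0 \<union> B0 = U"
    using False z by auto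
  have G: "finite A" "A \<in> simple_graphs n" "card A = i"
    "\<And>v. v \<in> {1..n} \<Longrightarrow> l v \<le> degree A v \<and> degree A v \<le> u v" if "A \<in> G i" for A i
    using that finite_simple_graph by (auto simp: G_def graphs_deg_edges_def graphs_deg_def)
  have finG: "finite (G i)" for i
    by (rule finite_subset[OF _ finite_simple_graphs[of n]])
      (auto simp: G_def graphs_deg_edges_def graphs_deg_def)
  define H where "H = U - C"
  define j where "j = card (A0 - C)"
  have fin: "finite A0" "finite B0" "finite C" "finite U" "finite H"
    using AB0 G(1)[of A0] G(1)[of B0] by (auto simp: H_def)
  have C0: "A0 \<inter> C = C" "B0 \<inter> C = C" using AB0(3) by auto
  have kC: "card C + j = k"
    using card_Int_add_Diff[OF fin(1), of C] G(3)[OF AB0(1)] unfolding j_def C0 by simp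
  have "card C + card (B0 - C) = k + 2"
    using card_Int_add_Diff[OF fin(2), of C] G(3)[OF AB0(2)] unfolding C0 by simp
  moreover have "H = (A0 - C) \<union> (B0 - C)" "(A0 - C) \<inter> (B0 - C) = {}"
    using AB0 by (auto simp: H_def)
  then have "card H = card (A0 - C) + card (B0 - C)"
    using fin by (simp add: card_Un_disjoint)
  \<comment> \<open>The reference pair has \<open>j\<close> red and \<open>j + 2\<close> blue
    edges.\<close>
  ultimately have cH: "card H = 2 * Suc j" using kC by (simp add: j_def)
  have simpU: "\<forall>e\<in>U. e \<subseteq> {1..n} \<and> card e = 2"
    using G(2)[OF AB0(1)] G(2)[OF AB0(2)] AB0(4) by (auto simp: simple_graphs_def)
  have CU: "C \<subseteq> U" using AB0 by auto
  have deg: "degree A i = degree C i + card ({e \<in> H. i \<in> e} \<inter> (A - C))"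
    "degree B i = degree C i + card ({e \<in> H. i \<in> e} - (A - C))"
    if "A \<inter> B = C" "A \<union> B = U" for A B i
    using degree_Int_Diff[of A B C U i] that fin(4) unfolding H_def by auto
  have bal: "balanced {e \<in> H. i \<in> e} (A - C) \<longleftrightarrow>
      degree A i \<le> degree B i + 1 \<and> degree B i \<le> degree A i + 1"
    if "A \<inter> B = C" "A \<union> B = U" for A B i
    using deg[OF that] fin(5) by (subst balanced_iff_Diff) auto
  have "card ?X \<le> card (balanced_subsets H (stars n H) j)"
  proof (rule card_inj_on_le)
    show "inj_on (\<lambda>p. fst p - C) ?X"
      using z by (intro inj_on_inverseI[where g = "\<lambda>R. (C \<union> R, U - R)"]) auto
    show "(\<lambda>p. fst p - C) ` ?X \<subseteq> balanced_subsets H (stars n H) j"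
    proof (rule image_subsetI)
      fix p assume p: "p \<in> ?X"
      obtain A B where AB': "p = (A, B)" by fastforce
      have A: "A \<in> G k" and B: "B \<in> G (k + 2)" and AB: "A \<inter> B = C" "A \<union> B = U"
        using p AB' z by auto
      then have AC: "A \<inter> C = C" by auto
      have "card (A - C) = j"
        using card_Int_add_Diff[OF G(1)[OF A], of C] G(3)[OF A] kC AC by simp
      \<comment> \<open>Both degrees lie in an interval of length at most one.\<close>
      moreover have "balanced {e \<in> H. i \<in> e} (A - C)" if "i \<in> {1..n}" for i
        using G(4)[OF A that] G(4)[OF B that] assms(1) that unfolding bal[OF AB] by fastforce
      ultimately show "fst p - C \<in> balanced_subsets H (stars n H) j"
        using AB AB' by (auto simp: balanced_subsets_def stars_def H_def)
    qed
  qed (use fin in simp)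
  also have "\<dots> \<le> card (balanced_subsets H (stars n H) (Suc j))"
  proof (rule card_balanced_subsets_mono[OF fin(5) cH])
    show "\<forall>S\<in>#stars n H. S \<subseteq> H" by (auto simp: stars_def)
    show "size {#S \<in># stars n H. e \<in> S#} \<le> 2" for e
      using stars_cover_le_2[of H] simpU by (auto simp: H_def)
  qed
  also have "\<dots> \<le> card ?Y"
  proof (rule card_inj_on_le)
    show "inj_on (\<lambda>R. (C \<union> R, U - R)) (balanced_subsets H (stars n H) (Suc j))"
      by (intro inj_on_inverseI[where g = "\<lambda>p. fst p - C"]) (auto simp: balanced_subsets_def H_def)
    show "finite ?Y" using finG by simp
    show "(\<lambda>R. (C \<union> R, U - R)) ` balanced_subsets H (stars n H) (Suc j) \<subseteq> ?Y"
    proof (rule image_subsetI)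
      fix R assume "R \<in> balanced_subsets H (stars n H) (Suc j)"
      then have R: "R \<subseteq> H" "card R = Suc j" "\<And>i. i \<in> {1..n} \<Longrightarrow> balanced {e \<in> H. i \<in> e} R"
        by (auto simp: balanced_subsets_def stars_def)
      let ?A = "C \<union> R" and ?B = "U - R"
      have AB: "?A \<inter> ?B = C" "?A \<union> ?B = U" and AC: "?A - C = R"
        using R(1) CU by (auto simp: H_def)
      have fR: "finite R" using R(1) fin(5) finite_subset by blast
      have cA: "card ?A = k + 1"
        using R fR fin(3) kC by (subst card_Un_disjoint) (auto simp: H_def)
      have "card U = card C + card H"
        using CU fin by (simp add: H_def card_Diff_subset card_mono)
      then have cB: "card ?B = k + 1"
        using R fR kC cH by (subst card_Diff_subset) (auto simp: H_def)
      have "l i \<le> degree ?A i \<and> degree ?A i \<le> u i \<and> l i \<le> degree ?B i \<and> degree ?B i \<le> u i"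
        if i: "i \<in> {1..n}" for i
      proof -
        let ?S = "{e \<in> H. i \<in> e}"
        have fS: "finite ?S" using fin(5) by simp
        have "degree ?A i + degree ?B i = 2 * degree C i + card ?S"
          using deg[OF AB, of i] card_Int_add_Diff[OF fS, of "?A - C"] by simp
        moreover have "degree A0 i + degree B0 i = 2 * degree C i + card ?S"
          using deg[OF AB0(3,4), of i] card_Int_add_Diff[OF fS, of "A0 - C"] by simp
        moreover have "degree ?A i \<le> degree ?B i + 1 \<and> degree ?B i \<le> degree ?A i + 1"
          using bal[OF AB, of i] R(3)[OF i] AC by simp
        \<comment> \<open>The degree sum agrees with that of \<open>A0\<close> and
          \<open>B0\<close>, and in both pairs the degrees differ by at most one; hence the two
          degrees are the same up to order.\<close>
        ultimately show ?thesis
          using G(4)[OF AB0(1) i] G(4)[OF AB0(2) i] by linarith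
      qed
      moreover have "?A \<in> simple_graphs n" "?B \<in> simple_graphs n"
        using simpU AB by (auto simp: simple_graphs_def)
      ultimately have "?A \<in> G (k + 1)" "?B \<in> G (k + 1)"
        using cA cB by (auto simp: G_def graphs_deg_edges_def graphs_deg_def)
      with AB z show "(?A, ?B) \<in> ?Y" by simp
    qed
  qed
  finally show ?thesis .
next
  case True
  show ?thesis unfolding True by simp
qed

section \<open>Log-concavity from the fibrewise comparison\<close>

theorem theorem5p4:
  fixes n :: nat and l u :: "nat \<Rightarrow> nat" and w :: "nat \<Rightarrow> nat" and m1 m2 :: nat
  assumes "\<forall>i\<in>{1..n}. u i \<in> {l i, l i + 1}"
    and "\<forall>m. w m = card (graphs_deg_edges n l u m)"
    and "m1 = Min (card ` graphs_deg n l u)"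
    and "m2 = Max (card ` graphs_deg n l u)"
  shows "\<forall>m. m1 < m \<and> m < m2 \<longrightarrow> w (m - 1) * w (m + 1) \<le> (w m)\<^sup>2"
proof (intro allI impI)
  fix m assume "m1 < m \<and> m < m2"
  \<comment> \<open>\<open>m1 < m\<close> makes \<open>m\<close> positive, so \<open>m - 1\<close>
    is a true predecessor.\<close>
  then obtain k where m: "m = k + 1" by (cases m) auto
  let ?G = "graphs_deg_edges n l u"
  have fin: "finite (?G i)" for i
    by (rule finite_subset[OF _ finite_simple_graphs[of n]])
      (auto simp: graphs_deg_edges_def graphs_deg_def)
  \<comment> \<open>Both products of counts are numbers of pairs of graphs, compared over each value
    of intersection and union.\<close>
  have "card (?G k \<times> ?G (k + 2)) \<le> card (?G (k + 1) \<times> ?G (k + 1))"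
    by (rule card_le_fibers[OF _ _ card_graph_pairs_fiber_le[OF assms(1)]]) (simp_all add: fin)
  then show "w (m - 1) * w (m + 1) \<le> (w m)\<^sup>2"
    using assms(2) by (simp add: m card_cartesian_product power2_eq_square)
qed

end
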